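(* Let $(M;\vee,\wedge,\oplus,0)$ be an EMV-algebra and let $(N;\vee,\wedge,\oplus,0)$ be its representing EMV-algebra with top element (with $M$ identified with its image in $N$). If $r:M\to M$ is a square root on $M$, then there exists a square root $R:N\to N$ on $N$ such that $r=R|_M$.
   Context: An EMV-algebra is an algebra $(M;\vee,\wedge,\oplus,0)$ of type $(2,2,2,0)$ such that: (E1) $(M;\vee,\wedge,0)$ is a distributive lattice with least element $0$; (E2) $(M;\oplus,0)$ is a commutative ordered monoid with neutral element $0$; (E3) writing $\mathcal I(M)=\{x\in M\mid x\oplus x=x\}$ (the idempotents), for each $a\in\mathcal I(M)$ and each $x\in[0,a]$ the element $\lambda_a(x)=\min\{z\in[0,a]\mid x\oplus z=a\}$ exists, and $([0,a];\oplus,\lambda_a,0,a)$ is an MV-algebra; (E4) for each $x\in M$ there is $a\in\mathcal I(M)$ with $x\le a$. A top element is not assumed. For $x,y\in M$, $x\odot y:=\lambda_a(\lambda_a(x)\oplus\lambda_a(y))$ for any $a\in\mathcal I(M)$ with $x,y\le a$ (this does not depend on $a$). A square root on $M$ is a map $s:M\to M$ such that (Sq1) $s(x)\odot s(x)=x$ for all $x\in M$; (Sq2) for all $x,y\in M$, $y\odot y\le x$ implies $y\le s(x)$. Representing EMV-algebra: if $M$ has a top element, then $N=M$. If $M$ has no top element, then $N$ is the (unique up to isomorphism) EMV-algebra with top element $1$ (equivalently, MV-algebra with $x'=\lambda_1(x)$) into which $M$ embeds as a maximal ideal such that every element of $N$ is either (the image of) an element of $M$ or the complement $x'$ of (the image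 of) an element $x$ of $M$; existence and uniqueness are known. *)

theory Defs
  imports "HOL-Algebra.Lattice" "HOL-Algebra.Group"
begin

no_notation join (infixl "\<squnion>\<index>" 65)
no_notation meet (infixl "\<sqinter>\<index>" 70)

record 'a emv = "'a partial_object" +
  vee :: "'a \<Rightarrow> 'a \<Rightarrow> 'a" (infixl "\<squnion>\<index>" 65)
  wedge :: "'a \<Rightarrow> 'a \<Rightarrow> 'a" (infixl "\<sqinter>\<index>" 70)
  oplus :: "'a \<Rightarrow> 'a \<Rightarrow> 'a" (infixl "\<oplus>\<index>" 65)
  zero :: 'a ("\<zero>\<index>")

text \<open>The order of an EMV-algebra is the order of its lattice reduct. It is packaged as a
  \<^typ>\<open>'a gorder\<close> so that the notions \<^const>\<open>least\<close> and \<^const>\<open>greatest\<close> of HOL-Algebra apply.\<close>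

definition emv_le :: "('a, 'b) emv_scheme \<Rightarrow> 'a \<Rightarrow> 'a \<Rightarrow> bool" (infixl "\<preceq>\<index>" 50)
  where "x \<preceq>\<^bsub>M\<^esub> y \<longleftrightarrow> x \<sqinter>\<^bsub>M\<^esub> y = x"

definition emv_order :: "('a, 'b) emv_scheme \<Rightarrow> 'a gorder"
  where "emv_order M = \<lparr>carrier = carrier M, eq = (=), le = emv_le M\<rparr>"

definition idempotents :: "('a, 'b) emv_scheme \<Rightarrow> 'a set"
  where "idempotents M = {x \<in> carrier M. x \<oplus>\<^bsub>M\<^esub> x = x}"

definition segment :: "('a, 'b) emv_scheme \<Rightarrow> 'a \<Rightarrow> 'a set"
  where "segment M a = {x \<in> carrier M. \<zero>\<^bsub>M\<^esub> \<preceq>\<^bsub>M\<^esub> x \<and> x \<preceq>\<^bsub>M\<^esub> a}"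

definition is_lam :: "('a, 'b) emv_scheme \<Rightarrow> 'a \<Rightarrow> 'a \<Rightarrow> 'a \<Rightarrow> bool"
  where "is_lam M a x l \<longleftrightarrow> least (emv_order M) l {z \<in> segment M a. x \<oplus>\<^bsub>M\<^esub> z = a}"

definition lam :: "('a, 'b) emv_scheme \<Rightarrow> 'a \<Rightarrow> 'a \<Rightarrow> 'a"
  where "lam M a x = (THE l. is_lam M a x l)"

locale mv_algebra =
  fixes A :: "'a set" and plus :: "'a \<Rightarrow> 'a \<Rightarrow> 'a" and neg :: "'a \<Rightarrow> 'a" and nil unit :: 'a
  assumes comm_monoid: "comm_monoid \<lparr>carrier = A, mult = plus, one = nil\<rparr>"
    and neg_closed: "x \<in> A \<Longrightarrow> neg x \<in> A"
    and unit_closed: "unit \<in> A"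
    and neg_nil: "neg nil = unit"
    and neg_neg: "x \<in> A \<Longrightarrow> neg (neg x) = x"
    and plus_unit: "x \<in> A \<Longrightarrow> plus x unit = unit"
    and lukasiewicz: "\<lbrakk>x \<in> A; y \<in> A\<rbrakk> \<Longrightarrow>
      plus (neg (plus (neg x) y)) y = plus (neg (plus (neg y) x)) x"

locale emv_algebra =
  fixes M :: "('a, 'b) emv_scheme" (structure)
  assumes vee_closed: "\<lbrakk>x \<in> carrier M; y \<in> carrier M\<rbrakk> \<Longrightarrow> x \<squnion> y \<in> carrier M"
    and wedge_closed: "\<lbrakk>x \<in> carrier M; y \<in> carrier M\<rbrakk> \<Longrightarrow> x \<sqinter> y \<in> carrier M"
    and vee_assoc: "\<lbrakk>x \<in> carrier M; y \<in> carrier M; z \<in> carrier M\<rbrakk> \<Longrightarrow>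
      (x \<squnion> y) \<squnion> z = x \<squnion> (y \<squnion> z)"
    and wedge_assoc: "\<lbrakk>x \<in> carrier M; y \<in> carrier M; z \<in> carrier M\<rbrakk> \<Longrightarrow>
      (x \<sqinter> y) \<sqinter> z = x \<sqinter> (y \<sqinter> z)"
    and vee_comm: "\<lbrakk>x \<in> carrier M; y \<in> carrier M\<rbrakk> \<Longrightarrow> x \<squnion> y = y \<squnion> x"
    and wedge_comm: "\<lbrakk>x \<in> carrier M; y \<in> carrier M\<rbrakk> \<Longrightarrow> x \<sqinter> y = y \<sqinter> x"
    and vee_absorb: "\<lbrakk>x \<in> carrier M; y \<in> carrier M\<rbrakk> \<Longrightarrow> x \<squnion> (x \<sqinter> y) = x"
    and wedge_absorb: "\<lbrakk>x \<in> carrier M; y \<in> carrier M\<rbrakk> \<Longrightarrow> x \<sqinter> (x \<squnion> y) = x"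
    and distrib: "\<lbrakk>x \<in> carrier M; y \<in> carrier M; z \<in> carrier M\<rbrakk> \<Longrightarrow>
      x \<sqinter> (y \<squnion> z) = (x \<sqinter> y) \<squnion> (x \<sqinter> z)"
    and zero_least: "x \<in> carrier M \<Longrightarrow> \<zero> \<preceq> x"
    and comm_monoid: "comm_monoid \<lparr>carrier = carrier M, mult = oplus M, one = zero M\<rparr>"
    and oplus_mono: "\<lbrakk>x \<in> carrier M; y \<in> carrier M; z \<in> carrier M; x \<preceq> y\<rbrakk> \<Longrightarrow>
      x \<oplus> z \<preceq> y \<oplus> z"
    and lam_exists: "\<lbrakk>a \<in> idempotents M; x \<in> segment M a\<rbrakk> \<Longrightarrow> \<exists>l. is_lam M a x l"
    and segment_mv: "a \<in> idempotents M \<Longrightarrow>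
      mv_algebra (segment M a) (oplus M) (lam M a) \<zero> a"
    and idempotent_above: "x \<in> carrier M \<Longrightarrow> \<exists>a \<in> idempotents M. x \<preceq> a"

text \<open>In an EMV-algebra the value below does not depend on the chosen idempotent \<open>a\<close>.\<close>

definition odot :: "('a, 'b) emv_scheme \<Rightarrow> 'a \<Rightarrow> 'a \<Rightarrow> 'a" (infixl "\<odot>\<index>" 70)
  where "x \<odot>\<^bsub>M\<^esub> y =
    (let a = (SOME a. a \<in> idempotents M \<and> x \<preceq>\<^bsub>M\<^esub> a \<and> y \<preceq>\<^bsub>M\<^esub> a)
     in lam M a (lam M a x \<oplus>\<^bsub>M\<^esub> lam M a y))"

definition square_root :: "('a, 'b) emv_scheme \<Rightarrow> ('a \<Rightarrow> 'a) \<Rightarrow> bool"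
  where "square_root M s \<longleftrightarrow>
    s \<in> carrier M \<rightarrow> carrier M \<and>
    (\<forall>x \<in> carrier M. s x \<odot>\<^bsub>M\<^esub> s x = x) \<and>
    (\<forall>x \<in> carrier M. \<forall>y \<in> carrier M. y \<odot>\<^bsub>M\<^esub> y \<preceq>\<^bsub>M\<^esub> x \<longrightarrow> y \<preceq>\<^bsub>M\<^esub> s x)"

definition is_top :: "('a, 'b) emv_scheme \<Rightarrow> 'a \<Rightarrow> bool"
  where "is_top M t \<longleftrightarrow> greatest (emv_order M) t (carrier M)"

definition emv_ideal :: "('a, 'b) emv_scheme \<Rightarrow> 'a set \<Rightarrow> bool"
  where "emv_ideal M I \<longleftrightarrow>
    I \<noteq> {} \<and> I \<subseteq> carrier M \<and>
    (\<forall>x \<in> carrier M. \<forall>y \<in> I. x \<preceq>\<^bsub>M\<^esub> y \<longrightarrow> x \<in> I) \<and>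
    (\<forall>x \<in> I. \<forall>y \<in> I. x \<oplus>\<^bsub>M\<^esub> y \<in> I)"

definition maximal_emv_ideal :: "('a, 'b) emv_scheme \<Rightarrow> 'a set \<Rightarrow> bool"
  where "maximal_emv_ideal M I \<longleftrightarrow>
    emv_ideal M I \<and> I \<noteq> carrier M \<and>
    (\<forall>J. emv_ideal M J \<and> I \<subseteq> J \<and> J \<noteq> carrier M \<longrightarrow> J = I)"

definition emv_hom :: "('a, 'c) emv_scheme \<Rightarrow> ('b, 'd) emv_scheme \<Rightarrow> ('a \<Rightarrow> 'b) \<Rightarrow> bool"
  where "emv_hom M N f \<longleftrightarrow>
    f \<in> carrier M \<rightarrow> carrier N \<and>
    (\<forall>x \<in> carrier M. \<forall>y \<in> carrier M.
       f (x \<squnion>\<^bsub>M\<^esub> y) = f x \<squnion>\<^bsub>N\<^esub> f y \<and>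
       f (x \<sqinter>\<^bsub>M\<^esub> y) = f x \<sqinter>\<^bsub>N\<^esub> f y \<and>
       f (x \<oplus>\<^bsub>M\<^esub> y) = f x \<oplus>\<^bsub>N\<^esub> f y) \<and>
    f \<zero>\<^bsub>M\<^esub> = \<zero>\<^bsub>N\<^esub> \<and>
    (\<forall>a \<in> idempotents M. \<forall>x \<in> segment M a. f (lam M a x) = lam N (f a) (f x))"

text \<open>\<open>N\<close>, together with the embedding \<open>i\<close>, is a representing EMV-algebra of \<open>M\<close>. If \<open>M\<close> has a
  top element, the usual convention \<open>N = M\<close> is read up to the isomorphism \<open>i\<close>; it is the special
  case in which \<open>i\<close> is the identity.\<close>

definition representing ::
    "('a, 'c) emv_scheme \<Rightarrow> ('b, 'd) emv_scheme \<Rightarrow> ('a \<Rightarrow> 'b) \<Rightarrow> bool"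
  where "representing M N i \<longleftrightarrow>
    emv_algebra N \<and> emv_hom M N i \<and> inj_on i (carrier M) \<and>
    (if \<exists>t. is_top M t then i ` carrier M = carrier N
     else \<exists>u. is_top N u \<and> maximal_emv_ideal N (i ` carrier M) \<and>
       (\<forall>y \<in> carrier N. \<exists>x \<in> carrier M. y = i x \<or> y = lam N u (i x)))"

end

theory Submission
  imports Defs
begin

text \<open>Let \<open>u\<close> be the top of \<open>N\<close>, and write \<open>x'\<close> for \<open>\<lambda>\<^sub>u x\<close>. If \<open>w = x'\<close> with \<open>x \<in> M\<close> and
  \<open>w \<odot> w = (x \<oplus> x)'\<close> lies in the ideal \<open>M\<close>, then so does \<open>u = (x \<oplus> x) \<oplus> (w \<odot> w)\<close>, hence \<open>w\<close>. So
  \<open>r\<close> provides roots relative to \<open>N\<close> for the elements of \<open>M\<close>. For \<open>z = x'\<close> with \<open>x \<in> M\<close>, pick an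
  idempotent \<open>a \<ge> x\<close> of \<open>M\<close>. Since \<open>a' \<le> z\<close>, splitting \<open>N \<cong> [0,a] \<times> [0,a']\<close> sends \<open>z\<close> to
  \<open>(z \<sqinter> a, a')\<close>, and its root is \<open>(r (z \<sqinter> a) \<sqinter> a) \<squnion> a'\<close>.\<close>

section \<open>EMV-algebras\<close>

context emv_algebra
begin

lemma oplus_closed [simp]: "\<lbrakk>x \<in> carrier M; y \<in> carrier M\<rbrakk> \<Longrightarrow> x \<oplus> y \<in> carrier M"
  using comm_monoid comm_monoid.axioms(1) monoid.m_closed by fastforce

lemma zero_closed [simp]: "\<zero> \<in> carrier M"
  using comm_monoid comm_monoid.axioms(1) monoid.one_closed by fastforce

lemma oplus_assoc:
  "\<lbrakk>x \<in> carrier M; y \<in> carrier M; z \<in> carrier M\<rbrakk> \<Longrightarrow> x \<oplus> y \<oplus> z = x \<oplus> (y \<oplus> z)"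
  using comm_monoid comm_monoid.axioms(1) monoid.m_assoc by fastforce

lemma oplus_comm: "\<lbrakk>x \<in> carrier M; y \<in> carrier M\<rbrakk> \<Longrightarrow> x \<oplus> y = y \<oplus> x"
  using comm_monoid comm_monoid.m_comm by fastforce

lemma zero_oplus [simp]: "x \<in> carrier M \<Longrightarrow> \<zero> \<oplus> x = x"
  using comm_monoid comm_monoid.axioms(1) monoid.l_one by fastforce

lemma oplus_zero [simp]: "x \<in> carrier M \<Longrightarrow> x \<oplus> \<zero> = x"
  using oplus_comm zero_oplus by simp

text \<open>Meet is idempotent: absorption gives \<open>x \<squnion> (x \<sqinter> x) = x\<close>,
  and substituting this into the dual law yields \<open>x \<sqinter> x = x\<close>.\<close>

lemma le_refl [simp]: "x \<in> carrier M \<Longrightarrow> x \<preceq> x"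
  unfolding emv_le_def using wedge_absorb[of x "x \<sqinter> x"] vee_absorb[of x x] wedge_closed by metis

lemma le_trans:
  "\<lbrakk>x \<preceq> y; y \<preceq> z; x \<in> carrier M; y \<in> carrier M; z \<in> carrier M\<rbrakk> \<Longrightarrow> x \<preceq> z"
  unfolding emv_le_def by (metis wedge_assoc)

lemma le_antisym: "\<lbrakk>x \<preceq> y; y \<preceq> x; x \<in> carrier M; y \<in> carrier M\<rbrakk> \<Longrightarrow> x = y"
  unfolding emv_le_def by (metis wedge_comm)

lemma wedge_le1: "\<lbrakk>x \<in> carrier M; y \<in> carrier M\<rbrakk> \<Longrightarrow> x \<sqinter> y \<preceq> x"
  unfolding emv_le_def by (metis le_refl emv_le_def wedge_assoc wedge_closed wedge_comm)

lemma wedge_le2: "\<lbrakk>x \<in> carrier M; y \<in> carrier M\<rbrakk> \<Longrightarrow> x \<sqinter> y \<preceq> y"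
  using wedge_le1 wedge_comm by metis

lemma wedge_greatest:
  "\<lbrakk>z \<preceq> x; z \<preceq> y; x \<in> carrier M; y \<in> carrier M; z \<in> carrier M\<rbrakk> \<Longrightarrow> z \<preceq> x \<sqinter> y"
  unfolding emv_le_def by (metis wedge_assoc)

lemma vee_ge1: "\<lbrakk>x \<in> carrier M; y \<in> carrier M\<rbrakk> \<Longrightarrow> x \<preceq> x \<squnion> y"
  unfolding emv_le_def by (rule wedge_absorb)

lemma vee_ge2: "\<lbrakk>x \<in> carrier M; y \<in> carrier M\<rbrakk> \<Longrightarrow> y \<preceq> x \<squnion> y"
  using vee_ge1 vee_comm by metis

lemma vee_least:
  "\<lbrakk>x \<preceq> z; y \<preceq> z; x \<in> carrier M; y \<in> carrier M; z \<in> carrier M\<rbrakk> \<Longrightarrow> x \<squnion> y \<preceq> z"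
  unfolding emv_le_def by (metis distrib wedge_comm vee_closed)

lemma oplus_mono2:
  "\<lbrakk>x \<preceq> y; x \<in> carrier M; y \<in> carrier M; z \<in> carrier M\<rbrakk> \<Longrightarrow> z \<oplus> x \<preceq> z \<oplus> y"
  using oplus_mono oplus_comm by metis

lemma le_oplus: "\<lbrakk>x \<in> carrier M; y \<in> carrier M\<rbrakk> \<Longrightarrow> x \<preceq> x \<oplus> y"
  using oplus_mono2[of \<zero> y x] zero_least by simp

lemma mem_segment: "x \<in> segment M a \<longleftrightarrow> x \<in> carrier M \<and> x \<preceq> a"
  unfolding segment_def using zero_least by blast

lemma is_lam_iff:
  "is_lam M a x l \<longleftrightarrow> l \<in> segment M a \<and> x \<oplus> l = a \<and>
     (\<forall>z \<in> segment M a. x \<oplus> z = a \<longrightarrow> l \<preceq> z)"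
  by (force simp: is_lam_def least_def emv_order_def mem_segment)

lemma lam_eqI:
  assumes "is_lam M a x l"
  shows "lam M a x = l"
proof -
  have "l' = l" if "is_lam M a x l'" for l'
    using that assms le_antisym[of l' l] by (simp add: is_lam_iff mem_segment)
  with assms show ?thesis
    unfolding lam_def by (rule the_equality)
qed

lemma is_lam_lam:
  assumes "a \<in> idempotents M" "x \<in> segment M a"
  shows "is_lam M a x (lam M a x)"
  using lam_exists[OF assms] lam_eqI by metis

lemma lam_in_segment: "\<lbrakk>a \<in> idempotents M; x \<in> segment M a\<rbrakk> \<Longrightarrow> lam M a x \<in> segment M a"
  using is_lam_lam is_lam_iff by blast

lemma oplus_in_segment:
  assumes "a \<in> idempotents M" "x \<in> segment M a" "y \<in> segment M a"
  shows "x \<oplus> y \<in> segment M a"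
proof -
  have "Group.monoid \<lparr>carrier = segment M a, mult = oplus M, one = \<zero>\<rparr>"
    using mv_algebra.comm_monoid[OF segment_mv[OF assms(1)]] by (rule comm_monoid.axioms(1))
  from monoid.m_closed[OF this] show ?thesis using assms by simp
qed

text \<open>Opens up the choice inside \<open>odot\<close>. It is well founded because some
  idempotent lies above \<open>x \<squnion> y\<close>, so facts valid for every idempotent above
  both factors apply.\<close>

lemma odot_witness:
  assumes "x \<in> carrier M" "y \<in> carrier M"
  obtains a where "a \<in> idempotents M" "x \<in> segment M a" "y \<in> segment M a"
    "x \<odot> y = lam M a (lam M a x \<oplus> lam M a y)"
proof -
  define a where "a = (SOME a. a \<in> idempotents M \<and> x \<preceq> a \<and> y \<preceq> a)"
  obtain b where b: "b \<in> idempotents M" "x \<squnion> y \<preceq> b"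
    using idempotent_above vee_closed assms by blast
  then have "b \<in> carrier M" by (simp add: idempotents_def)
  then have "b \<in> idempotents M \<and> x \<preceq> b \<and> y \<preceq> b"
    using b assms le_trans[OF vee_ge1 b(2)] le_trans[OF vee_ge2 b(2)] by (simp add: vee_closed)
  then have "a \<in> idempotents M \<and> x \<preceq> a \<and> y \<preceq> a"
    unfolding a_def by (rule someI)
  moreover have "x \<odot> y = lam M a (lam M a x \<oplus> lam M a y)"
    unfolding odot_def a_def by (simp add: Let_def)
  ultimately show ?thesis using that[of a] assms by (simp add: mem_segment)
qed

lemma odot_closed: "\<lbrakk>x \<in> carrier M; y \<in> carrier M\<rbrakk> \<Longrightarrow> x \<odot> y \<in> carrier M"
  by (metis odot_witness lam_in_segment oplus_in_segment mem_segment)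

end

lemma is_top_iff: "is_top M t \<longleftrightarrow> t \<in> carrier M \<and> (\<forall>x \<in> carrier M. x \<preceq>\<^bsub>M\<^esub> t)"
  by (simp add: is_top_def greatest_def emv_order_def conj_commute)

section \<open>EMV-algebras with a top element\<close>

locale emv_algebra_top = emv_algebra +
  fixes u
  assumes top: "is_top M u"
begin

abbreviation neg where "neg x \<equiv> lam M u x"

definition mul (infixl "\<cdot>" 70) where "x \<cdot> y = neg (neg x \<oplus> neg y)"

lemma top_closed [simp]: "u \<in> carrier M" and le_top: "x \<in> carrier M \<Longrightarrow> x \<preceq> u"
  using top by (simp_all add: is_top_iff)

lemma top_oplus [simp]: "x \<in> carrier M \<Longrightarrow> u \<oplus> x = u"
  by (rule le_antisym) (simp_all add: le_oplus le_top)

lemma top_idem: "u \<in> idempotents M"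
  by (simp add: idempotents_def)

lemma segment_top: "segment M u = carrier M"
  using mem_segment le_top by blast

sublocale mv: mv_algebra "carrier M" "oplus M" "lam M u" \<zero> u
  using segment_mv[OF top_idem] by (simp add: segment_top)

declare mv.neg_closed [simp] mv.neg_neg [simp] mv.neg_nil [simp]

lemma neg_top [simp]: "neg u = \<zero>"
  using mv.neg_neg[of \<zero>] by simp

section \<open>Complement and residuated product\<close>

text \<open>The complement is the least \<open>z\<close> with \<open>x \<oplus> z = u\<close>, and
  by monotonicity the set of such \<open>z\<close> is upward closed, so it consists of everything
  above \<open>neg x\<close>.\<close>

lemma neg_le_iff:
  assumes "x \<in> carrier M" "z \<in> carrier M"
  shows "neg x \<preceq> z \<longleftrightarrow> x \<oplus> z = u"
proof -
  have l: "x \<oplus> neg x = u" "\<And>z. z \<in> carrier M \<Longrightarrow> x \<oplus> z = u \<Longrightarrow> neg x \<preceq> z"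
    using is_lam_lam[OF top_idem, of x] assms by (auto simp: is_lam_iff segment_top)
  show ?thesis
    using l assms oplus_mono2[of "neg x" z x] le_top le_antisym[of "x \<oplus> z" u] by auto
qed

lemma le_iff: "\<lbrakk>x \<in> carrier M; y \<in> carrier M\<rbrakk> \<Longrightarrow> x \<preceq> y \<longleftrightarrow> neg x \<oplus> y = u"
  using neg_le_iff[of "neg x" y] by simp

lemma neg_le_neg_iff: "\<lbrakk>x \<in> carrier M; y \<in> carrier M\<rbrakk> \<Longrightarrow> neg x \<preceq> neg y \<longleftrightarrow> y \<preceq> x"
  using neg_le_iff[of x "neg y"] le_iff[of y x] oplus_comm[of x "neg y"] by simp

lemma mul_closed [simp]: "\<lbrakk>x \<in> carrier M; y \<in> carrier M\<rbrakk> \<Longrightarrow> x \<cdot> y \<in> carrier M"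
  by (simp add: mul_def)

lemma mul_comm: "\<lbrakk>x \<in> carrier M; y \<in> carrier M\<rbrakk> \<Longrightarrow> x \<cdot> y = y \<cdot> x"
  by (simp add: mul_def oplus_comm)

lemma mul_assoc:
  "\<lbrakk>x \<in> carrier M; y \<in> carrier M; z \<in> carrier M\<rbrakk> \<Longrightarrow> x \<cdot> y \<cdot> z = x \<cdot> (y \<cdot> z)"
  by (simp add: mul_def oplus_assoc)

lemma mul_lcomm:
  "\<lbrakk>x \<in> carrier M; y \<in> carrier M; z \<in> carrier M\<rbrakk> \<Longrightarrow> x \<cdot> (y \<cdot> z) = y \<cdot> (x \<cdot> z)"
  using mul_assoc mul_comm by metis

text \<open>Residuation: both sides unfold to
  \<open>neg x \<oplus> neg y \<oplus> z = u\<close>.\<close>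

lemma mul_le_iff:
  assumes "x \<in> carrier M" "y \<in> carrier M" "z \<in> carrier M"
  shows "x \<cdot> y \<preceq> z \<longleftrightarrow> x \<preceq> neg y \<oplus> z"
  using assms by (simp add: mul_def neg_le_iff le_iff oplus_assoc)

lemma mul_mono:
  assumes "x \<preceq> x'" "y \<preceq> y'"
    and "x \<in> carrier M" "y \<in> carrier M" "x' \<in> carrier M" "y' \<in> carrier M"
  shows "x \<cdot> y \<preceq> x' \<cdot> y'"
proof -
  have "neg x' \<oplus> neg y' \<preceq> neg x \<oplus> neg y"
    using assms le_trans[OF oplus_mono oplus_mono2] by (simp add: neg_le_neg_iff)
  then show ?thesis using assms by (simp add: mul_def neg_le_neg_iff)
qed

lemma mul_le1: "\<lbrakk>x \<in> carrier M; y \<in> carrier M\<rbrakk> \<Longrightarrow> x \<cdot> y \<preceq> x"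
  using neg_le_neg_iff[of "neg x \<oplus> neg y" "neg x"] le_oplus[of "neg x" "neg y"]
  by (simp add: mul_def)

lemma mul_le2: "\<lbrakk>x \<in> carrier M; y \<in> carrier M\<rbrakk> \<Longrightarrow> x \<cdot> y \<preceq> y"
  using mul_le1 mul_comm by metis

lemma mul_neg: "x \<in> carrier M \<Longrightarrow> x \<cdot> neg x = \<zero>"
  using neg_le_iff[of x "neg x"] by (simp add: mul_def oplus_comm)

text \<open>Multiplication by \<open>z\<close> has the right adjoint
  \<open>t \<mapsto> neg z \<oplus> t\<close>, so it preserves joins.\<close>

lemma vee_mul:
  assumes "x \<in> carrier M" "y \<in> carrier M" "z \<in> carrier M"
  shows "(x \<squnion> y) \<cdot> z = x \<cdot> z \<squnion> y \<cdot> z"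
proof (rule le_antisym)
  have "x \<preceq> neg z \<oplus> (x \<cdot> z \<squnion> y \<cdot> z)" "y \<preceq> neg z \<oplus> (x \<cdot> z \<squnion> y \<cdot> z)"
    using assms by (simp_all add: mul_le_iff[symmetric] vee_closed vee_ge1 vee_ge2)
  then show "(x \<squnion> y) \<cdot> z \<preceq> x \<cdot> z \<squnion> y \<cdot> z"
    using assms by (simp add: mul_le_iff vee_closed vee_least)
  show "x \<cdot> z \<squnion> y \<cdot> z \<preceq> (x \<squnion> y) \<cdot> z"
    using assms by (simp add: vee_least mul_mono vee_closed vee_ge1 vee_ge2)
qed (use assms in \<open>simp_all add: vee_closed\<close>)

text \<open>The Lukasiewicz axiom, dualised by \<open>neg\<close>: both sides are the MV-algebraic meet.\<close>

lemma mul_neg_oplus_comm: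
  assumes "x \<in> carrier M" "y \<in> carrier M"
  shows "x \<cdot> (neg x \<oplus> y) = y \<cdot> (neg y \<oplus> x)"
  using mv.lukasiewicz[of "neg x" "neg y"] assms by (simp add: mul_def oplus_comm)

text \<open>Divisibility: for \<open>x \<preceq> y\<close> the other form of the MV-meet,
  \<open>x \<cdot> (neg x \<oplus> y)\<close>, collapses to \<open>x \<cdot> u\<close>.\<close>

lemma mul_neg_oplus_of_le:
  assumes "x \<preceq> y" "x \<in> carrier M" "y \<in> carrier M"
  shows "y \<cdot> (neg y \<oplus> x) = x"
proof -
  have "x \<cdot> u = x" using assms by (simp add: mul_def)
  then show ?thesis using assms mul_neg_oplus_comm[of x y] by (simp add: le_iff)
qed

section \<open>Idempotents as Boolean elements\<close>

text \<open>The two forms of the MV-meet of \<open>a\<close> and \<open>neg a\<close> are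
  \<open>a \<cdot> (neg a \<oplus> neg a)\<close> and
  \<open>neg a \<cdot> (a \<oplus> a) = neg a \<cdot> a = \<zero>\<close>. Residuation then bounds
  \<open>neg a \<oplus> neg a\<close> by \<open>neg a\<close>.\<close>

lemma neg_idem:
  assumes "a \<in> idempotents M"
  shows "neg a \<in> idempotents M"
proof -
  have a: "a \<in> carrier M" "a \<oplus> a = a" using assms by (auto simp: idempotents_def)
  then have "(neg a \<oplus> neg a) \<cdot> a = \<zero>"
    using mul_neg_oplus_comm[of a "neg a"] mul_comm[of _ a] mul_comm[of "neg a" a] mul_neg[of a]
    by simp
  then have "neg a \<oplus> neg a \<preceq> neg a"
    using mul_le_iff[of "neg a \<oplus> neg a" a \<zero>] a by simp
  then show ?thesis
    using a le_antisym le_oplus by (simp add: idempotents_def)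
qed

lemma mul_idem: "a \<in> idempotents M \<Longrightarrow> a \<cdot> a = a"
  using neg_idem[of a] by (simp add: idempotents_def mul_def)

text \<open>By divisibility \<open>x\<close> already has a factor \<open>a\<close>, which absorbs a
  further one since \<open>a \<cdot> a = a\<close>.\<close>

lemma mul_idem_of_le:
  assumes "a \<in> idempotents M" "x \<preceq> a" "x \<in> carrier M"
  shows "x \<cdot> a = x"
proof -
  have a: "a \<in> carrier M" "a \<cdot> a = a" using assms mul_idem by (auto simp: idempotents_def)
  have "x \<cdot> a = a \<cdot> (neg a \<oplus> x) \<cdot> a"
    using assms a by (simp add: mul_neg_oplus_of_le)
  also have "\<dots> = a \<cdot> a \<cdot> (neg a \<oplus> x)"
    using assms a by (metis mul_assoc mul_comm mv.neg_closed oplus_closed)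
  finally show ?thesis using assms a by (simp add: mul_neg_oplus_of_le)
qed

text \<open>A product lies below both factors; conversely \<open>x \<sqinter> a\<close> equals its
  own product with \<open>a\<close>, which is at most \<open>x \<cdot> a\<close>.\<close>

lemma wedge_idem:
  assumes "a \<in> idempotents M" "x \<in> carrier M"
  shows "x \<sqinter> a = x \<cdot> a"
proof -
  have a: "a \<in> carrier M" using assms by (auto simp: idempotents_def)
  have "(x \<sqinter> a) \<cdot> a = x \<sqinter> a"
    using assms a by (simp add: mul_idem_of_le wedge_le2 wedge_closed)
  moreover have "(x \<sqinter> a) \<cdot> a \<preceq> x \<cdot> a"
    using assms a by (simp add: mul_mono wedge_le1 wedge_closed)
  ultimately show ?thesis
    using assms a by (intro le_antisym) (simp_all add: wedge_greatest mul_le1 mul_le2 wedge_closed)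
qed

text \<open>De Morgan: the complement of the join lies below \<open>neg a \<sqinter> a\<close>,
  which is a product by idempotency and hence zero.\<close>

lemma vee_neg_idem:
  assumes "a \<in> idempotents M"
  shows "a \<squnion> neg a = u"
proof -
  have a: "a \<in> carrier M" using assms by (auto simp: idempotents_def)
  have "neg (a \<squnion> neg a) \<preceq> neg a \<sqinter> a"
    using a neg_le_neg_iff[of "a \<squnion> neg a" a] neg_le_neg_iff[of "a \<squnion> neg a" "neg a"]
    by (simp add: wedge_greatest vee_closed vee_ge1 vee_ge2)
  also have "neg a \<sqinter> a = neg u"
    using assms a by (simp add: wedge_idem mul_comm[of "neg a"] mul_neg)
  finally have "u \<preceq> a \<squnion> neg a"
    using a by (simp only: neg_le_neg_iff vee_closed mv.neg_closed top_closed)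
  then show ?thesis using a by (simp add: le_antisym le_top vee_closed)
qed

text \<open>Recovers an element from its two coordinates at \<open>a\<close> and
  \<open>neg a\<close>, by distributivity over \<open>a \<squnion> neg a = u\<close>.\<close>

lemma split_idem:
  assumes "a \<in> idempotents M" "x \<in> carrier M"
  shows "x \<sqinter> a \<squnion> x \<sqinter> neg a = x"
proof -
  have a: "a \<in> carrier M" using assms by (auto simp: idempotents_def)
  then have "x \<sqinter> a \<squnion> x \<sqinter> neg a = x \<sqinter> u"
    using assms by (simp add: distrib[symmetric] vee_neg_idem)
  then show ?thesis using assms le_top unfolding emv_le_def by simp
qed

section \<open>Independence of the product from the idempotent\<close>

text \<open>By residuation \<open>a \<cdot> neg x \<preceq> z\<close> means
  \<open>a \<preceq> x \<oplus> z\<close>. Hence \<open>a \<cdot> neg x\<close> bounds every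
  solution of \<open>x \<oplus> z = a\<close> from below, and it is itself a solution because sums
  within the segment stay below \<open>a\<close>.\<close>

lemma lam_eq:
  assumes "a \<in> idempotents M" "x \<in> segment M a"
  shows "lam M a x = a \<cdot> neg x"
proof (rule lam_eqI)
  have a: "a \<in> carrier M" "a \<oplus> a = a" using assms by (auto simp: idempotents_def)
  have x: "x \<in> carrier M" "x \<preceq> a" using assms by (auto simp: mem_segment)
  have "x \<oplus> a \<cdot> neg x \<preceq> a"
    using oplus_in_segment[OF assms, of "a \<cdot> neg x"] a x by (simp add: mem_segment mul_le1)
  moreover have "a \<preceq> x \<oplus> a \<cdot> neg x"
    using mul_le_iff[of a "neg x" "a \<cdot> neg x"] a x by simp
  ultimately have "x \<oplus> a \<cdot> neg x = a" using a x by (simp add: le_antisym)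
  moreover have "a \<cdot> neg x \<preceq> z" if "z \<in> carrier M" "x \<oplus> z = a" for z
    using mul_le_iff[of a "neg x" z] a x that by simp
  ultimately show "is_lam M a x (a \<cdot> neg x)"
    unfolding is_lam_iff using a x by (simp add: mem_segment mul_le1)
qed

text \<open>The right-hand side does not mention \<open>a\<close>: this is the independence of
  \<open>odot\<close> from the chosen idempotent.\<close>

lemma lam_oplus_lam:
  assumes "a \<in> idempotents M" "x \<in> segment M a" "y \<in> segment M a"
  shows "lam M a (lam M a x \<oplus> lam M a y) = x \<cdot> y"
proof -
  have a: "a \<in> carrier M" "a \<cdot> a = a" using assms mul_idem by (auto simp: idempotents_def)
  have x: "x \<in> carrier M" "x \<preceq> a" and y: "y \<in> carrier M" "y \<preceq> a"
    using assms by (auto simp: mem_segment)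
  have *: "neg (a \<cdot> neg t) = neg a \<oplus> t" if "t \<in> carrier M" for t
    using a that by (simp add: mul_def)
  have "lam M a (lam M a x \<oplus> lam M a y) = a \<cdot> neg (lam M a x \<oplus> lam M a y)"
    using assms by (intro lam_eq oplus_in_segment lam_in_segment)
  also have "\<dots> = a \<cdot> neg (a \<cdot> neg x \<oplus> a \<cdot> neg y)"
    using assms by (simp add: lam_eq)
  also have "neg (a \<cdot> neg x \<oplus> a \<cdot> neg y) = (neg a \<oplus> x) \<cdot> (neg a \<oplus> y)"
    unfolding mul_def[of "neg a \<oplus> x"] using *[OF x(1)] *[OF y(1)] a x y
    by (metis mul_closed mv.neg_closed mv.neg_neg)
  \<comment> \<open>Duplicating \<open>a\<close> by \<open>a \<cdot> a = a\<close> gives each factor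
    its own copy, so divisibility reduces the factors to \<open>x\<close> and
    \<open>y\<close>.\<close>
  also have "a \<cdot> \<dots> = a \<cdot> (neg a \<oplus> x) \<cdot> (a \<cdot> (neg a \<oplus> y))"
    using a x y by (metis mul_assoc mul_lcomm mul_closed mv.neg_closed oplus_closed)
  finally show ?thesis using a x y by (simp add: mul_neg_oplus_of_le)
qed

lemma odot_eq:
  assumes "x \<in> carrier M" "y \<in> carrier M"
  shows "x \<odot> y = x \<cdot> y"
  using odot_witness[OF assms] lam_oplus_lam by metis

section \<open>Square roots computed in coordinates\<close>

text \<open>Squaring is coordinatewise: the cross terms \<open>q \<cdot> neg a\<close> vanish since
  \<open>q \<preceq> a\<close>, and \<open>neg a\<close> is its own square.\<close>

lemma vee_neg_square:
  assumes a: "a \<in> idempotents M" and q: "q \<in> carrier M" "q \<preceq> a"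
  shows "(q \<squnion> neg a) \<cdot> (q \<squnion> neg a) = q \<cdot> q \<squnion> neg a"
proof -
  have ac: "a \<in> carrier M" using a by (auto simp: idempotents_def)
  have "q \<cdot> neg a \<preceq> \<zero>"
    using mul_mono[of q a "neg a" "neg a"] ac q by (simp add: mul_neg)
  then have 0: "q \<cdot> neg a = \<zero>" "neg a \<cdot> q = \<zero>"
    using ac q mul_comm[of q "neg a"] by (simp_all add: le_antisym zero_least)
  have [simp]: "x \<squnion> \<zero> = x" "\<zero> \<squnion> x = x" if "x \<in> carrier M" for x
    using that vee_absorb[of x \<zero>] zero_least[of x] vee_comm[of x \<zero>] wedge_comm[of x \<zero>]
    by (simp_all add: emv_le_def)
  have "q \<cdot> (q \<squnion> neg a) = q \<cdot> q" "neg a \<cdot> (q \<squnion> neg a) = neg a"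
    using ac q 0 neg_idem[OF a]
    by (simp_all add: mul_comm[of _ "q \<squnion> neg a"] vee_closed vee_mul mul_idem)
  then show ?thesis using ac q by (simp add: vee_mul vee_closed)
qed

text \<open>Maximality of \<open>t\<close> is asked only against elements below \<open>a\<close>,
  the ones that can be pulled back to \<open>M\<close>. An arbitrary competitor is compared
  coordinate by coordinate.\<close>

lemma square_root_above_neg_idem:
  assumes a: "a \<in> idempotents M" and z: "z \<in> carrier M" "neg a \<preceq> z"
    and t: "t \<in> carrier M" "t \<cdot> t = z \<sqinter> a"
    and max: "\<And>w. \<lbrakk>w \<in> carrier M; w \<preceq> a; w \<cdot> w \<preceq> z \<sqinter> a\<rbrakk> \<Longrightarrow> w \<preceq> t"
  defines "s \<equiv> t \<sqinter> a \<squnion> neg a"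
  shows "s \<in> carrier M" "s \<cdot> s = z" "\<And>w. \<lbrakk>w \<in> carrier M; w \<cdot> w \<preceq> z\<rbrakk> \<Longrightarrow> w \<preceq> s"
proof -
  have ac: "a \<in> carrier M" using a by (auto simp: idempotents_def)
  show sc: "s \<in> carrier M" using ac t by (simp add: s_def vee_closed wedge_closed)
  \<comment> \<open>Since \<open>t\<close> need not lie below \<open>a\<close>, it is truncated; the
    square is unchanged because \<open>t \<cdot> t\<close> is already below
    \<open>a\<close>.\<close>
  have "(t \<sqinter> a) \<cdot> (t \<sqinter> a) = t \<cdot> t \<cdot> (a \<cdot> a)"
    using ac t(1) a by (metis wedge_idem mul_assoc mul_comm mul_closed)
  also have "\<dots> = z \<sqinter> a"
    using ac z t a by (simp add: mul_idem mul_idem_of_le wedge_closed wedge_le2)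
  finally have q: "(t \<sqinter> a) \<cdot> (t \<sqinter> a) = z \<sqinter> a" .
  have "z \<sqinter> neg a = neg a"
    using z ac wedge_comm unfolding emv_le_def by simp
  then show "s \<cdot> s = z"
    using split_idem[OF a z(1)] vee_neg_square[OF a, of "t \<sqinter> a"] ac t(1) q
    by (simp add: s_def wedge_closed wedge_le2)
  fix w assume w: "w \<in> carrier M" "w \<cdot> w \<preceq> z"
  have wa: "w \<sqinter> a \<in> carrier M" "w \<sqinter> a \<preceq> w" "w \<sqinter> a \<preceq> a"
    using w ac by (simp_all add: wedge_closed wedge_le1 wedge_le2)
  have "(w \<sqinter> a) \<cdot> (w \<sqinter> a) \<preceq> w \<cdot> w" using wa w by (simp add: mul_mono)
  then have "(w \<sqinter> a) \<cdot> (w \<sqinter> a) \<preceq> z" using le_trans[OF _ w(2)] wa w z by simp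
  moreover have "(w \<sqinter> a) \<cdot> (w \<sqinter> a) \<preceq> a"
    using le_trans[OF mul_le1 wa(3)] wa ac by simp
  ultimately have "w \<sqinter> a \<preceq> t"
    using wa ac z by (intro max) (simp_all add: wedge_greatest)
  then have "w \<sqinter> a \<preceq> t \<sqinter> a"
    using wa ac t by (simp add: wedge_greatest)
  then have 1: "w \<sqinter> a \<preceq> s"
    unfolding s_def using wa ac t le_trans[OF _ vee_ge1] by (simp add: wedge_closed vee_closed)
  \<comment> \<open>The second coordinate of \<open>s\<close> is the largest possible one, so
    nothing about \<open>w\<close> is needed here.\<close>
  have 2: "w \<sqinter> neg a \<preceq> s"
    unfolding s_def using w ac t le_trans[OF wedge_le2 vee_ge2]
    by (simp add: wedge_closed vee_closed)
  show "w \<preceq> s"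
    using vee_least[OF 1 2] split_idem[OF a w(1)] w ac sc by (simp add: wedge_closed)
qed

end

section \<open>Transfer along the embedding\<close>

lemma maximal_emv_ideal_downward:
  assumes "maximal_emv_ideal M I" "x \<in> carrier M" "y \<in> I" "x \<preceq>\<^bsub>M\<^esub> y"
  shows "x \<in> I"
proof -
  have "emv_ideal M I" using assms(1) by (simp add: maximal_emv_ideal_def)
  then have "\<forall>x \<in> carrier M. \<forall>y \<in> I. x \<preceq>\<^bsub>M\<^esub> y \<longrightarrow> x \<in> I" by (simp add: emv_ideal_def)
  then show ?thesis using assms(2-4) by blast
qed

text \<open>Makes the two cases uniform. If \<open>M\<close> has a top, \<open>i\<close> is onto, so
  the image of that top is the top of \<open>N\<close> and the other two claims are immediate;
  otherwise the image is an ideal, hence downward closed.\<close>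

lemma representingD:
  assumes rep: "representing M N i"
  obtains u where "is_top N u"
    and "\<And>x y. \<lbrakk>x \<in> carrier N; y \<in> carrier M; x \<preceq>\<^bsub>N\<^esub> i y\<rbrakk> \<Longrightarrow> x \<in> i ` carrier M"
    and "\<And>y. y \<in> carrier N \<Longrightarrow> \<exists>x \<in> carrier M. y = i x \<or> y = lam N u (i x)"
proof (cases "\<exists>t. is_top M t")
  case True
  then obtain t where t: "is_top M t" by blast
  have im: "i ` carrier M = carrier N"
    using rep True by (simp add: representing_def)
  have hom: "i (x \<sqinter>\<^bsub>M\<^esub> y) = i x \<sqinter>\<^bsub>N\<^esub> i y" if "x \<in> carrier M" "y \<in> carrier M" for x y
    using rep that by (simp add: representing_def emv_hom_def)
  have "is_top N (i t)"
    using t by (auto simp: is_top_iff im[symmetric] emv_le_def simp flip: hom)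
  moreover have "\<exists>x \<in> carrier M. y = i x \<or> y = lam N (i t) (i x)" if "y \<in> carrier N" for y
    using that im by blast
  ultimately show ?thesis using that[of "i t"] im by simp
next
  case False
  then obtain u where u: "is_top N u" "maximal_emv_ideal N (i ` carrier M)"
    "\<forall>y \<in> carrier N. \<exists>x \<in> carrier M. y = i x \<or> y = lam N u (i x)"
    using rep by (auto simp: representing_def)
  have "x \<in> i ` carrier M" if "x \<in> carrier N" "y \<in> carrier M" "x \<preceq>\<^bsub>N\<^esub> i y" for x y
    using maximal_emv_ideal_downward[OF u(2) that(1) _ that(3)] that(2) by simp
  then show ?thesis using u that[of u] by simp
qed

theorem theorem4p5:
  fixes M :: "'a emv" and N :: "'b emv" and i :: "'a \<Rightarrow> 'b" and r :: "'a \<Rightarrow> 'a"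
  assumes "emv_algebra M"
    and "representing M N i"
    and "square_root M r"
  shows "\<exists>R. square_root N R \<and> (\<forall>x \<in> carrier M. R (i x) = i (r x))"
proof -
  obtain u where u: "is_top N u"
    and down: "\<And>x y. \<lbrakk>x \<in> carrier N; y \<in> carrier M; x \<preceq>\<^bsub>N\<^esub> i y\<rbrakk> \<Longrightarrow> x \<in> i ` carrier M"
    and cover: "\<And>y. y \<in> carrier N \<Longrightarrow> \<exists>x \<in> carrier M. y = i x \<or> y = lam N u (i x)"
    using representingD[OF assms(2)] by metis
  interpret M: emv_algebra M by fact
  interpret N: emv_algebra_top N u
    using assms(2) u
    by (auto simp: representing_def emv_algebra_top_def emv_algebra_top_axioms_def)
  have hom: "emv_hom M N i" and inj: "inj_on i (carrier M)"
    using assms(2) by (auto simp: representing_def)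
  have ic [simp]: "i x \<in> carrier N" if "x \<in> carrier M" for x
    using hom that unfolding emv_hom_def by blast
  have i_wedge: "i (x \<sqinter>\<^bsub>M\<^esub> y) = i x \<sqinter>\<^bsub>N\<^esub> i y" and i_oplus: "i (x \<oplus>\<^bsub>M\<^esub> y) = i x \<oplus>\<^bsub>N\<^esub> i y"
    if "x \<in> carrier M" "y \<in> carrier M" for x y
    using hom that unfolding emv_hom_def by blast+
  have i_lam: "i (lam M a x) = lam N (i a) (i x)" if "a \<in> idempotents M" "x \<in> segment M a" for a x
    using hom that unfolding emv_hom_def by blast
  have i_le: "i x \<preceq>\<^bsub>N\<^esub> i y \<longleftrightarrow> x \<preceq>\<^bsub>M\<^esub> y" if "x \<in> carrier M" "y \<in> carrier M" for x y
    using that inj unfolding emv_le_def by (metis i_wedge inj_on_eq_iff M.wedge_closed)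
  have i_idem: "i a \<in> idempotents N" if "a \<in> idempotents M" for a
    using that i_oplus[of a a] by (auto simp: idempotents_def)
  have i_segment: "i x \<in> segment N (i a)" if "a \<in> idempotents M" "x \<in> segment M a" for a x
    using that i_le by (auto simp: M.mem_segment N.mem_segment idempotents_def)
  \<comment> \<open>The embedding carries the formula for the idempotent chosen in \<open>M\<close>
    to the one for its image, and in \<open>N\<close> any idempotent above both factors gives the
    same product.\<close>
  have i_odot: "i (x \<odot>\<^bsub>M\<^esub> y) = N.mul (i x) (i y)" if xy: "x \<in> carrier M" "y \<in> carrier M" for x y
  proof -
    obtain a where a: "a \<in> idempotents M" "x \<in> segment M a" "y \<in> segment M a"
      and eq: "x \<odot>\<^bsub>M\<^esub> y = lam M a (lam M a x \<oplus>\<^bsub>M\<^esub> lam M a y)"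
      using M.odot_witness[OF xy] by blast
    have l: "lam M a x \<in> segment M a" "lam M a y \<in> segment M a"
      using a M.lam_in_segment by blast+
    then have "lam M a x \<in> carrier M" "lam M a y \<in> carrier M"
      using M.mem_segment by blast+
    then have "i (x \<odot>\<^bsub>M\<^esub> y) = lam N (i a) (lam N (i a) (i x) \<oplus>\<^bsub>N\<^esub> lam N (i a) (i y))"
      using a l by (simp add: eq i_lam i_oplus M.oplus_in_segment)
    then show ?thesis
      using a by (simp add: N.lam_oplus_lam i_idem i_segment)
  qed
  have r_closed [simp]: "r x \<in> carrier M"
    and r_square: "N.mul (i (r x)) (i (r x)) = i x" if "x \<in> carrier M" for x
    using assms(3) that i_odot[of "r x" "r x"] unfolding square_root_def by (auto simp: Pi_iff)
  have r_max: "i y \<preceq>\<^bsub>N\<^esub> i (r x)"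
    if "x \<in> carrier M" "y \<in> carrier M" "N.mul (i y) (i y) \<preceq>\<^bsub>N\<^esub> i x" for x y
  proof -
    have "y \<odot>\<^bsub>M\<^esub> y \<preceq>\<^bsub>M\<^esub> x"
      using that i_odot[of y y] i_le[of "y \<odot>\<^bsub>M\<^esub> y" x] by (simp add: M.odot_closed)
    then show ?thesis
      using assms(3) that i_le[of y "r x"] unfolding square_root_def by simp
  qed
  have image_square: "y \<in> i ` carrier M"
    if y: "y \<in> carrier N" "x \<in> carrier M" "N.mul y y \<preceq>\<^bsub>N\<^esub> i x" for x y
  proof (rule ccontr)
    assume "y \<notin> i ` carrier M"
    then obtain z where z: "z \<in> carrier M" "y = lam N u (i z)"
      using cover y by blast
    let ?w = "z \<oplus>\<^bsub>M\<^esub> z"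
    have "N.mul y y = lam N u (i ?w)"
      using z by (simp add: N.mul_def i_oplus)
    then obtain v where v: "v \<in> carrier M" "lam N u (i ?w) = i v"
      using down[of "N.mul y y" x] y N.mul_closed by (metis imageE)
    \<comment> \<open>Both \<open>i ?w\<close> and its complement \<open>i v\<close> lie in the
      image, so their sum \<open>u\<close> does too, and downward closure then puts \<open>y\<close>
      there.\<close>
    have "i (?w \<oplus>\<^bsub>M\<^esub> v) = u"
      using N.neg_le_iff[of "i ?w" "i v"] v z by (simp add: i_oplus[of ?w v])
    then have "y \<in> i ` carrier M"
      using down[of y "?w \<oplus>\<^bsub>M\<^esub> v"] N.le_top y v z by simp
    then show False using \<open>y \<notin> i ` carrier M\<close> by contradiction
  qed
  \<comment> \<open>Being a root is stated pointwise, with competitors from all of \<open>N\<close>.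
    This determines \<open>s\<close>, so \<open>R\<close> can be chosen without a case distinction
    and must agree with \<open>r\<close> on the image.\<close>
  define P where "P z s \<longleftrightarrow> s \<in> carrier N \<and> N.mul s s = z \<and>
    (\<forall>w \<in> carrier N. N.mul w w \<preceq>\<^bsub>N\<^esub> z \<longrightarrow> w \<preceq>\<^bsub>N\<^esub> s)" for z s
  have P_image: "P (i x) (i (r x))" if "x \<in> carrier M" for x
    unfolding P_def
  proof (intro conjI ballI impI)
    fix w assume w: "w \<in> carrier N" "N.mul w w \<preceq>\<^bsub>N\<^esub> i x"
    then obtain y where "y \<in> carrier M" "w = i y" using image_square \<open>x \<in> carrier M\<close> by blast
    then show "w \<preceq>\<^bsub>N\<^esub> i (r x)" using w that by (simp add: r_max)
  qed (use that in \<open>simp_all add: r_square\<close>)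
  \<comment> \<open>Each root is a competitor for the other, so each lies below the other.\<close>
  have P_unique: "s = s'" if "z \<in> carrier N" "P z s" "P z s'" for z s s'
    using that N.le_antisym[of s s'] unfolding P_def by simp
  have P_exists: "\<exists>s. P z s" if z: "z \<in> carrier N" for z
  proof -
    obtain x where x: "x \<in> carrier M" "z = i x \<or> z = lam N u (i x)"
      using cover z by blast
    show ?thesis
    proof (cases "z = i x")
      case True
      then show ?thesis using P_image x by blast
    next
      case False
      obtain a where a: "a \<in> idempotents M" "x \<preceq>\<^bsub>M\<^esub> a" using M.idempotent_above x by blast
      then have ac: "a \<in> carrier M" by (simp add: idempotents_def)
      have za: "lam N u (i a) \<preceq>\<^bsub>N\<^esub> z"
        using False x a ac by (simp add: N.neg_le_neg_iff i_le)
      \<comment> \<open>The first coordinate of \<open>z\<close> lies below \<open>i a\<close>,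
        hence comes from \<open>M\<close>, where \<open>r\<close> supplies its root.\<close>
      obtain p where p: "p \<in> carrier M" "z \<sqinter>\<^bsub>N\<^esub> i a = i p"
        using down[of "z \<sqinter>\<^bsub>N\<^esub> i a" a] z ac by (auto simp: N.wedge_closed N.wedge_le2)
      have "w \<preceq>\<^bsub>N\<^esub> i (r p)"
        if w: "w \<in> carrier N" "w \<preceq>\<^bsub>N\<^esub> i a" "N.mul w w \<preceq>\<^bsub>N\<^esub> z \<sqinter>\<^bsub>N\<^esub> i a" for w
      proof -
        obtain y where "y \<in> carrier M" "w = i y" using down w(1,2) ac by blast
        then show ?thesis using w(3) p by (simp add: r_max)
      qed
      then show ?thesis
        using N.square_root_above_neg_idem[OF i_idem[OF a(1)] z za, of "i (r p)"] p r_square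
        unfolding P_def by auto
    qed
  qed
  define R where "R z = (SOME s. P z s)" for z
  have PR: "P z (R z)" if "z \<in> carrier N" for z
    unfolding R_def using P_exists[OF that] by (rule someI_ex)
  then have "square_root N R"
    unfolding square_root_def P_def by (auto simp: N.odot_eq)
  moreover have "R (i x) = i (r x)" if "x \<in> carrier M" for x
    using P_unique[OF _ PR P_image] that by simp
  ultimately show ?thesis by blast
qed

end
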